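(* Any algorithm for the explicit vertex stream model which finds a $c$-approximation to $\alpha(G)$ with probability at least $2/3$ requires $\Omega\left(\frac{n^2}{c^7}\right)$ space, where $n$ is the number of vertices of the input graph $G$.
   Context: In an explicit vertex stream, the vertices $v_1,\dots,v_n$ of a graph $G$ arrive one at a time in arbitrary order, and each vertex $v_i$ arrives together with the list of all its edges to previously arrived vertices $v_j$, $j<i$; the stream is read once. $\alpha(G)$ denotes the maximum size of an independent set of $G$. An algorithm returns a $c$-approximation to $\alpha(G)$ if it returns a value $\gamma$ with $\frac{1}{c}\alpha(G)\le\gamma\le\alpha(G)$. *)

theory Defs
  imports "HOL-Probability.Probability" "HOL-Library.Ramsey"
begin

definition simple_graph :: "nat set \<Rightarrow> nat set set \<Rightarrow> bool" where
  "simple_graph V E \<longleftrightarrow> finite V \<and> E \<subseteq> [V]\<^bsup>2\<^esup>"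

definition independence_number :: "nat set \<Rightarrow> nat set set \<Rightarrow> nat" where
  "independence_number V E = Max {card S | S. S \<subseteq> V \<and> indep S E}"

text \<open>A stream item \<open>(v, us)\<close> is the arrival of the vertex \<open>v\<close>; its edges to the previously
  arrived vertices are listed, in any order, by their other endpoints \<open>us\<close>.\<close>

type_synonym arrival = "nat \<times> nat list"

definition explicit_vertex_stream :: "nat set \<Rightarrow> nat set set \<Rightarrow> arrival list \<Rightarrow> bool" where
  "explicit_vertex_stream V E xs \<longleftrightarrow>
     distinct (map fst xs) \<and> fst ` set xs = V \<and>
     (\<forall>i<length xs. distinct (snd (xs ! i)) \<and>
        set (snd (xs ! i)) = {u \<in> fst ` set (take i xs). {u, fst (xs ! i)} \<in> E})"

text \<open>A deterministic one-pass algorithm. The memory content is a bit string, and between two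
  arrivals the algorithm keeps nothing but this bit string. Computation time and the working space
  needed within a single step are not restricted.\<close>

record stream_alg =
  initial_memory :: "bool list"
  update_memory :: "bool list \<Rightarrow> arrival \<Rightarrow> bool list"
  answer :: "bool list \<Rightarrow> real"

definition memory_after :: "stream_alg \<Rightarrow> arrival list \<Rightarrow> bool list" where
  "memory_after A xs = foldl (update_memory A) (initial_memory A) xs"

definition result :: "stream_alg \<Rightarrow> arrival list \<Rightarrow> real" where
  "result A xs = answer A (memory_after A xs)"

definition space_on :: "stream_alg \<Rightarrow> arrival list \<Rightarrow> nat" where
  "space_on A xs = Max ((\<lambda>i. length (memory_after A (take i xs))) ` {..length xs})"

definition is_approx :: "real \<Rightarrow> real \<Rightarrow> real \<Rightarrow> bool" where
  "is_approx c \<alpha> \<gamma> \<longleftrightarrow> 1 / c * \<alpha> \<le> \<gamma> \<and> \<gamma> \<le> \<alpha>"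

text \<open>A randomised algorithm is a probability distribution \<open>M\<close> over deterministic ones: drawing
  from \<open>M\<close> fixes all coin tosses, and access to the coins is not charged as space.
  The distribution may depend on the number \<open>n\<close> of vertices, whose labels are \<open>0, \<dots>, n - 1\<close>.
  The graph and the arrival order are fixed before the coins are tossed.\<close>

definition approximates_independence_number ::
    "stream_alg measure \<Rightarrow> nat \<Rightarrow> real \<Rightarrow> real \<Rightarrow> bool" where
  "approximates_independence_number M n c p \<longleftrightarrow>
     (\<forall>E xs. simple_graph {..<n} E \<and> explicit_vertex_stream {..<n} E xs \<longrightarrow>
        measure M {A \<in> space M.
          is_approx c (real (independence_number {..<n} E)) (result A xs)} \<ge> p)"

definition uses_space :: "stream_alg measure \<Rightarrow> nat \<Rightarrow> nat \<Rightarrow> bool" where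
  "uses_space M n s \<longleftrightarrow>
     (AE A in M. \<forall>E xs. simple_graph {..<n} E \<and> explicit_vertex_stream {..<n} E xs \<longrightarrow>
        space_on A xs \<le> s)"

text \<open>If \<open>n \<le> c\<close>, always answering \<open>1\<close> is a \<open>c\<close>-approximation for \<open>n > 0\<close> and needs no
  memory at all, so a positive lower bound on the space in this range is meant for \<open>s > 0\<close> only.\<close>

end

theory Submission
  imports Defs
begin

text \<open>
  Put \<open>k = \<lfloor>2c\<rfloor> + 1\<close>. The graph consists of \<open>k\<close> blocks arriving one after the other. A block is a
  grid of \<open>k\<close> columns, each of which is a clique; it hides one bit per line \<open>y = a x + b\<close>, the points
  of a line forming a clique if the bit is set and an independent set otherwise. Two lines share at
  most one point, so the bits can be chosen freely. For every block a line \<open>i\<close> is selected,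
  which is revealed only after the block: later vertices are adjacent to the whole block except
  for the points of \<open>i\<close>. If the bits of all selected lines are \<open>0\<close>, the selected points form an
  independent set of size \<open>k\<^sup>2\<close>; if they are all \<open>1\<close>, no independent set has more than \<open>2 k\<close> elements.
  As \<open>k > 2 c\<close>, a \<open>c\<close>-approximation distinguishes the two cases. By a hybrid argument the memory
  content after some block then predicts a random bit of that block with advantage of order
  \<open>1 / k\<close>, and a bound on moment generating functions shows that \<open>s\<close> bits of memory about \<open>m\<close> random
  bits give an advantage of order at most \<open>sqrt (s / m)\<close>. With about \<open>n\<^sup>2 / k\<^sup>5\<close> lines in a
  block, this yields \<open>s = \<Omega>(n\<^sup>2 / k\<^sup>7)\<close>.
\<close>

section \<open>The one-way communication bound\<close>

text \<open>The bounds exp(+-x) \<le> 1 +- x + x^2 add up with the linear terms cancelling: a random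
  sign has a subgaussian moment generating function.\<close>

lemma exp_add_exp_minus_le:
  fixes x :: real
  assumes "0 \<le> x" "x \<le> 1"
  shows "exp x + exp (- x) \<le> 2 * exp (x\<^sup>2)"
proof -
  \<comment> \<open>The product equals \<open>1 + x ^ 3\<close>.\<close>
  have "1 \<le> (1 + x) * (1 - x + x\<^sup>2)"
    using assms by (simp add: algebra_simps power2_eq_square)
  also have "\<dots> \<le> exp x * (1 - x + x\<^sup>2)"
    using assms exp_ge_add_one_self[of x] by (intro mult_right_mono) auto
  finally have "exp (- x) \<le> 1 - x + x\<^sup>2"
    by (simp add: exp_minus field_simps)
  moreover have "exp x \<le> 1 + x + x\<^sup>2"
    using assms by (intro exp_bound) auto
  ultimately show ?thesis
    using exp_ge_add_one_self[of "x\<^sup>2"] by linarith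
qed

text \<open>Up to the factor \<open>2 ^ card L\<close>, this is the moment generating function of a
  sum of independent signs, which factorises.\<close>

lemma sum_Pow_exp_signed:
  fixes t :: "'a \<Rightarrow> real"
  assumes "finite L"
  shows "(\<Sum>X\<in>Pow L. exp (\<Sum>i\<in>L. (if i \<in> X then 1 else - 1) * t i)) = (\<Prod>i\<in>L. exp (t i) + exp (- t i))"
  using assms
proof (induction L)
  case empty
  then show ?case by simp
next
  case (insert a L)
  let ?e = "\<lambda>L X. exp (\<Sum>i\<in>L. (if i \<in> X then 1 else - 1) * t i)"
  have inj: "inj_on (insert a) (Pow L)"
    using insert.hyps by (auto simp: inj_on_def)
  have 1: "?e (insert a L) X = exp (- t a) * ?e L X" if "X \<in> Pow L" for X
    using insert.hyps that by (auto simp: exp_add)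
  have 2: "?e (insert a L) (insert a X) = exp (t a) * ?e L X" if "X \<in> Pow L" for X
  proof -
    have "(\<Sum>i\<in>L. (if i \<in> insert a X then 1 else - 1) * t i) = (\<Sum>i\<in>L. (if i \<in> X then 1 else - 1) * t i)"
      using insert.hyps by (intro sum.cong) auto
    then show ?thesis
      using insert.hyps by (simp add: exp_add)
  qed
  have "(\<Sum>X\<in>Pow (insert a L). ?e (insert a L) X) =
      (\<Sum>X\<in>Pow L. ?e (insert a L) X) + (\<Sum>X\<in>insert a ` Pow L. ?e (insert a L) X)"
    unfolding Pow_insert using insert.hyps by (intro sum.union_disjoint) auto
  also have "\<dots> = (\<Sum>X\<in>Pow L. exp (- t a) * ?e L X) + (\<Sum>X\<in>Pow L. exp (t a) * ?e L X)"
    using 1 2 by (simp only: sum.reindex[OF inj] o_def cong: sum.cong)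
  also have "\<dots> = (exp (t a) + exp (- t a)) * (\<Sum>X\<in>Pow L. ?e L X)"
    by (simp add: sum_distrib_left sum.distrib distrib_right)
  finally show ?case
    using insert by simp
qed

text \<open>\<open>f X\<close> is a message about \<open>X\<close>, and \<open>g q i\<close> the
  receiver's acceptance on query \<open>i\<close>. For a fixed message the correlation is a sum of
  independent terms; letting the message depend on \<open>X\<close> costs
  \<open>ln (card Q)\<close>, as in a union bound.\<close>

lemma index_correlation_bound:
  fixes f :: "'a set \<Rightarrow> 'b" and g :: "'b \<Rightarrow> 'a \<Rightarrow> real" and x :: real
  assumes "finite L" "finite Q" and fQ: "\<And>X. X \<subseteq> L \<Longrightarrow> f X \<in> Q"
    and g: "\<And>q i. 0 \<le> g q i" "\<And>q i. g q i \<le> 1" and x: "0 < x" "x \<le> 1"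
  shows "(\<Sum>X\<in>Pow L. \<Sum>i\<in>L. (if i \<in> X then 1 else - 1) * g (f X) i)
           \<le> 2 ^ card L * (ln (card Q) / x + x * card L)"
proof -
  define h where "h q X = (\<Sum>i\<in>L. (if i \<in> X then 1 else - 1) * g q i)" for q X
  define T where "T = ln (card Q) + x\<^sup>2 * card L"
  have "card Q > 0"
    using fQ[of "{}"] \<open>finite Q\<close> by (auto simp: card_gt_0_iff)
  have mgf: "(\<Sum>X\<in>Pow L. exp (x * h q X)) \<le> 2 ^ card L * exp (x\<^sup>2 * card L)" for q
  proof -
    have "(\<Sum>X\<in>Pow L. exp (x * h q X)) = (\<Prod>i\<in>L. exp (x * g q i) + exp (- (x * g q i)))"
      unfolding h_def sum_Pow_exp_signed[OF \<open>finite L\<close>, symmetric]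
      by (simp add: sum_distrib_left mult.left_commute)
    also have "\<dots> \<le> (\<Prod>i\<in>L. 2 * exp (x\<^sup>2))"
    proof (intro prod_mono conjI)
      fix i
      have le: "0 \<le> x * g q i" "x * g q i \<le> x"
        using g x by (auto simp: mult_left_le)
      then have "exp (x * g q i) + exp (- (x * g q i)) \<le> 2 * exp ((x * g q i)\<^sup>2)"
        using x by (intro exp_add_exp_minus_le) linarith+
      also have "\<dots> \<le> 2 * exp (x\<^sup>2)"
        using le by (simp add: power_mono)
      finally show "exp (x * g q i) + exp (- (x * g q i)) \<le> 2 * exp (x\<^sup>2)" .
    qed (simp add: add_nonneg_nonneg)
    also have "\<dots> = 2 ^ card L * exp (x\<^sup>2 * card L)"
      by (simp add: power_mult_distrib exp_of_nat2_mult)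
    finally show ?thesis .
  qed
  \<comment> \<open>Jensen's inequality in tangent form: \<open>y \<le> T - 1 + exp (y - T)\<close>.
    Summing over all of \<open>Q\<close> removes the dependence of the message on
    \<open>X\<close>.\<close>
  have "(\<Sum>X\<in>Pow L. x * h (f X) X) \<le> (\<Sum>X\<in>Pow L. (T - 1) + exp (- T) * (\<Sum>q\<in>Q. exp (x * h q X)))"
  proof (intro sum_mono)
    fix X assume "X \<in> Pow L"
    have "x * h (f X) X - T \<le> exp (x * h (f X) X - T) - 1"
      using exp_ge_add_one_self[of "x * h (f X) X - T"] by linarith
    also have "exp (x * h (f X) X - T) = exp (- T) * exp (x * h (f X) X)"
      by (simp flip: exp_add)
    also have "exp (x * h (f X) X) \<le> (\<Sum>q\<in>Q. exp (x * h q X))"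
      using \<open>X \<in> Pow L\<close> fQ \<open>finite Q\<close> by (intro member_le_sum) auto
    finally show "x * h (f X) X \<le> (T - 1) + exp (- T) * (\<Sum>q\<in>Q. exp (x * h q X))"
      by simp
  qed
  also have "\<dots> = 2 ^ card L * (T - 1) + exp (- T) * (\<Sum>q\<in>Q. \<Sum>X\<in>Pow L. exp (x * h q X))"
    using \<open>finite L\<close> by (simp add: sum.distrib card_Pow sum.swap[of _ Q] flip: sum_distrib_left)
  also have "\<dots> \<le> 2 ^ card L * (T - 1) + exp (- T) * (\<Sum>q\<in>Q. 2 ^ card L * exp (x\<^sup>2 * card L))"
    by (intro add_left_mono mult_left_mono sum_mono mgf) auto
  also have "\<dots> = 2 ^ card L * (T - 1) + exp (- T) * (2 ^ card L * (card Q * exp (x\<^sup>2 * card L)))"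
    by simp
  also have "card Q * exp (x\<^sup>2 * card L) = exp T"
    using \<open>card Q > 0\<close> by (simp add: T_def exp_add)
  also have "2 ^ card L * (T - 1) + exp (- T) * (2 ^ card L * exp T) = 2 ^ card L * T"
    by (simp add: exp_minus field_simps)
  finally have "x * (\<Sum>X\<in>Pow L. h (f X) X) \<le> 2 ^ card L * T"
    by (simp add: sum_distrib_left)
  then have "(\<Sum>X\<in>Pow L. h (f X) X) \<le> 2 ^ card L * T / x"
    using x by (simp add: field_simps)
  also have "\<dots> = 2 ^ card L * (ln (card Q) / x + x * card L)"
    using x by (simp add: T_def field_simps power2_eq_square)
  finally show ?thesis
    by (simp add: h_def)
qed

section \<open>Hybrid argument and averaging\<close>

lemma sum_lists_length_Suc:
  assumes "finite B"
  shows "(\<Sum>w | set w \<subseteq> B \<and> length w = Suc k. F w) = (\<Sum>b\<in>B. \<Sum>w | set w \<subseteq> B \<and> length w = k. F (b # w))"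
proof -
  have "{w. set w \<subseteq> B \<and> length w = Suc k} = (\<lambda>(b, w). b # w) ` (B \<times> {w. set w \<subseteq> B \<and> length w = k})"
    by (auto simp: length_Suc_conv image_iff)
  moreover have "inj_on (\<lambda>(b, w). b # w) (B \<times> {w. set w \<subseteq> B \<and> length w = k})"
    by (auto simp: inj_on_def)
  ultimately show ?thesis
    by (simp add: sum.reindex sum.cartesian_product case_prod_unfold)
qed

text \<open>Letters of \<open>B\<close> are exchanged for letters of \<open>C\<close> one position
  at a time; each of the \<open>k\<close> exchanges happens within \<open>card B ^ (k - 1)\<close>
  surrounding words.\<close>

lemma hybrid_bound:
  fixes F :: "'a list \<Rightarrow> real" and D :: real
  assumes "finite B" "finite C" "card C = card B"
    and "\<And>p r. length p + length r + 1 = k \<Longrightarrow>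
      (\<Sum>b\<in>B. F (p @ b # r)) - (\<Sum>b\<in>C. F (p @ b # r)) \<le> D"
  shows "(\<Sum>w | set w \<subseteq> B \<and> length w = k. F w) - (\<Sum>w | set w \<subseteq> C \<and> length w = k. F w)
          \<le> k * card B ^ (k - 1) * D"
  using assms(4)
proof (induction k arbitrary: F)
  case 0
  have "{w. set w \<subseteq> B \<and> length w = 0} = {[]}" "{w. set w \<subseteq> C \<and> length w = 0} = {[]}"
    by auto
  then show ?case by simp
next
  case (Suc k)
  let ?B = "{w. set w \<subseteq> B \<and> length w = k}" and ?C = "{w. set w \<subseteq> C \<and> length w = k}"
  \<comment> \<open>First the tail is exchanged behind a head from \<open>B\<close>, then the head
    in front of a tail from \<open>C\<close>.\<close>
  have "(\<Sum>w | set w \<subseteq> B \<and> length w = Suc k. F w) - (\<Sum>w | set w \<subseteq> C \<and> length w = Suc k. F w) =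
      (\<Sum>b\<in>B. (\<Sum>w\<in>?B. F (b # w)) - (\<Sum>w\<in>?C. F (b # w))) +
      (\<Sum>w\<in>?C. (\<Sum>b\<in>B. F (b # w)) - (\<Sum>b\<in>C. F (b # w)))"
    by (simp add: sum_lists_length_Suc assms sum_subtractf sum.swap[of _ ?C])
  also have "\<dots> \<le> (\<Sum>b\<in>B. k * card B ^ (k - 1) * D) + (\<Sum>w\<in>?C. D)"
  proof (intro add_mono sum_mono)
    fix b
    show "(\<Sum>w\<in>?B. F (b # w)) - (\<Sum>w\<in>?C. F (b # w)) \<le> k * card B ^ (k - 1) * D"
    proof (rule Suc.IH)
      fix p r :: "'a list"
      assume "length p + length r + 1 = k"
      then show "(\<Sum>c\<in>B. F (b # p @ c # r)) - (\<Sum>c\<in>C. F (b # p @ c # r)) \<le> D"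
        using Suc.prems[of "b # p" r] by simp
    qed
  next
    fix w assume "w \<in> ?C"
    then show "(\<Sum>b\<in>B. F (b # w)) - (\<Sum>b\<in>C. F (b # w)) \<le> D"
      using Suc.prems[of "[]" w] by simp
  qed
  also have "\<dots> = Suc k * card B ^ (Suc k - 1) * D"
    using assms(1-3) card_lists_length_eq[of C k] by (cases k) (simp_all add: algebra_simps)
  finally show ?case .
qed

text \<open>Averaging over the coins: a bound on how many instances almost every deterministic
  algorithm solves carries over to the sum of the success probabilities.\<close>

lemma (in prob_space) sum_prob_le_if_AE:
  assumes "finite I" "\<And>i. i \<in> I \<Longrightarrow> S i \<in> events"
    and "AE x in M. (\<Sum>i\<in>I. indicator (S i) x) \<le> (C :: real)"
  shows "(\<Sum>i\<in>I. prob (S i)) \<le> C"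
proof -
  have int: "integrable M (indicator (S i) :: _ \<Rightarrow> real)" if "i \<in> I" for i
    using assms(2)[OF that] by (intro integrable_real_indicator) (auto simp: emeasure_eq_measure)
  have "(\<Sum>i\<in>I. prob (S i)) = (\<Sum>i\<in>I. expectation (indicator (S i)))"
    using assms(2) sets.sets_into_space by (intro sum.cong) (auto simp: Int_absorb2)
  also have "\<dots> = expectation (\<lambda>x. \<Sum>i\<in>I. indicator (S i) x)"
    using int by (intro Bochner_Integration.integral_sum[symmetric])
  also have "\<dots> \<le> C"
    using int assms(3) by (intro integral_le_const Bochner_Integration.integrable_sum) auto
  finally show ?thesis .
qed


section \<open>Graphs and streams from adjacency predicates\<close>

definition graph_edges :: "nat \<Rightarrow> (nat \<Rightarrow> nat \<Rightarrow> bool) \<Rightarrow> nat set set" where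
  "graph_edges n adj = {{u, v} | u v. u < v \<and> v < n \<and> adj u v}"

definition arrival_of :: "(nat \<Rightarrow> nat \<Rightarrow> bool) \<Rightarrow> nat \<Rightarrow> arrival" where
  "arrival_of adj v = (v, filter (\<lambda>u. adj u v) [0..<v])"

definition graph_stream :: "nat \<Rightarrow> (nat \<Rightarrow> nat \<Rightarrow> bool) \<Rightarrow> arrival list" where
  "graph_stream n adj = map (arrival_of adj) [0..<n]"

lemma in_graph_edges_iff:
  "u < v \<Longrightarrow> {u, v} \<in> graph_edges n adj \<longleftrightarrow> v < n \<and> adj u v"
  by (auto simp: graph_edges_def doubleton_eq_iff)

lemma simple_graph_graph_edges: "simple_graph {..<n} (graph_edges n adj)"
  by (auto simp: simple_graph_def graph_edges_def nsets_def)

lemma explicit_vertex_stream_graph_stream: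
  "explicit_vertex_stream {..<n} (graph_edges n adj) (graph_stream n adj)"
  by (auto simp: explicit_vertex_stream_def graph_stream_def arrival_of_def o_def take_map image_image
      in_graph_edges_iff atLeast0LessThan)

lemma indep_graph_edgesI:
  assumes "\<And>u v. u \<in> S \<Longrightarrow> v \<in> S \<Longrightarrow> u < v \<Longrightarrow> \<not> adj u v"
  shows "indep S (graph_edges n adj)"
  unfolding indep_def
proof (intro ballI impI)
  fix u v assume "u \<in> S" "v \<in> S" "u \<noteq> v"
  then show "{u, v} \<notin> graph_edges n adj"
    using assms in_graph_edges_iff[of u v] in_graph_edges_iff[of v u]
    by (metis insert_commute linorder_neqE_nat)
qed

lemma indep_graph_edgesD:
  assumes "indep S (graph_edges n adj)" "S \<subseteq> {..<n}" "u \<in> S" "v \<in> S" "u < v"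
  shows "\<not> adj u v"
  using assms in_graph_edges_iff[of u v n adj] by (auto simp: indep_def)

section \<open>Bounds on independence number and memory\<close>

lemma finite_indep_cards: "finite V \<Longrightarrow> finite {card S | S. S \<subseteq> V \<and> indep S E}"
  by (rule finite_subset[of _ "card ` Pow V"]) auto

lemma card_le_independence_number:
  "finite V \<Longrightarrow> S \<subseteq> V \<Longrightarrow> indep S E \<Longrightarrow> card S \<le> independence_number V E"
  unfolding independence_number_def by (rule Max_ge[OF finite_indep_cards]) auto

lemma independence_number_le:
  assumes "finite V" "\<And>S. S \<subseteq> V \<Longrightarrow> indep S E \<Longrightarrow> card S \<le> b"
  shows "independence_number V E \<le> b"
  unfolding independence_number_def
proof (rule Max.boundedI[OF finite_indep_cards])
  have "{} \<subseteq> V \<and> indep {} E" by simp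
  then show "{card S | S. S \<subseteq> V \<and> indep S E} \<noteq> {}" by blast
qed (use assms in auto)

lemma length_memory_after_le_space_on:
  "length (memory_after A (take i xs)) \<le> space_on A xs"
proof -
  \<comment> \<open>Beyond the end of the stream \<open>take\<close> returns all of it, so
    \<open>i\<close> may be unbounded.\<close>
  have "take i xs = take (min i (length xs)) xs"
    by (simp add: min_def)
  then show ?thesis
    unfolding space_on_def by (intro Max_ge) (auto intro!: image_eqI[where x = "min i (length xs)"])
qed

section \<open>The chain of blocks\<close>

text \<open>The pair \<open>(a, b)\<close> stands for the line \<open>y = a x + b\<close>. A vertex \<open>u\<close> is read as
  \<open>u = (j * k + x) * W + y\<close> with \<open>x < k\<close> and \<open>y < W\<close>, the point \<open>(x, y)\<close> of block \<open>j\<close>.\<close>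

type_synonym line = "nat \<times> nat"

definition block :: "nat \<Rightarrow> nat \<Rightarrow> nat \<Rightarrow> nat" where
  "block k W u = u div W div k"

definition column :: "nat \<Rightarrow> nat \<Rightarrow> nat \<Rightarrow> nat" where
  "column k W u = u div W mod k"

definition on_line :: "nat \<Rightarrow> nat \<Rightarrow> line \<Rightarrow> nat \<Rightarrow> bool" where
  "on_line k W l u \<longleftrightarrow> u mod W = fst l * column k W u + snd l"

text \<open>The entry \<open>(X, i)\<close> of \<open>w\<close> at position \<open>j\<close> gives the set \<open>X\<close> of lines that are cliques in block \<open>j\<close>
  and the line \<open>i\<close> selected there. The relation is only meant for \<open>u < v\<close>. Vertices beyond block
  \<open>k - 1\<close> pad the graph to \<open>n\<close> vertices and are adjacent to everything.\<close>

definition chain_adj :: "nat \<Rightarrow> nat \<Rightarrow> (line set \<times> line) list \<Rightarrow> nat \<Rightarrow> nat \<Rightarrow> bool" where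
  "chain_adj k W w u v \<longleftrightarrow>
     block k W v \<ge> k \<or>
     block k W u < block k W v \<and> \<not> on_line k W (snd (w ! block k W u)) u \<or>
     block k W u = block k W v \<and>
       (column k W u = column k W v \<or>
        (\<exists>l \<in> fst (w ! block k W v). on_line k W l u \<and> on_line k W l v))"

section \<open>Geometry of the grid\<close>

lemma vertex_eqI:
  assumes "block k W u = block k W v" "column k W u = column k W v" "u mod W = v mod W"
  shows "u = v"
  using assms unfolding block_def column_def by (metis div_mod_decomp)

lemma block_mono: "u \<le> v \<Longrightarrow> block k W u \<le> block k W v"
  by (simp add: block_def div_le_mono)

text \<open>This is what makes the bits independent: a pair of points in different columns is
  governed by at most one line.\<close>

lemma line_unique:
  assumes "on_line k W l u" "on_line k W l v" "on_line k W l' u" "on_line k W l' v"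
    and "column k W u \<noteq> column k W v"
  shows "l = l'"
proof -
  obtain a b a' b' where l: "l = (a, b)" "l' = (a', b')"
    by (cases l, cases l')
  let ?x = "column k W u" and ?y = "column k W v"
  have eq: "a * ?x + b = a' * ?x + b'" "a * ?y + b = a' * ?y + b'"
    using assms(1-4) by (simp_all add: on_line_def l)
  \<comment> \<open>Integers avoid truncated subtraction.\<close>
  then have "(int a - int a') * (int ?x - int ?y) = 0"
    by (simp add: algebra_simps flip: of_nat_mult of_nat_add)
  then have "a = a'"
    using assms(5) by simp
  then show ?thesis
    using eq l by simp
qed

lemma column_less: "k > 0 \<Longrightarrow> column k W u < k"
  by (simp add: column_def)

text \<open>Each selected line is a clique, so the selected lines contribute at most
  \<open>k\<close> vertices. An unselected point is adjacent to all later blocks, which confines the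
  rest to one block with \<open>k\<close> column cliques.\<close>

lemma independence_number_chain_intersecting:
  assumes k: "k > 0" and w: "length w = k" "\<And>X i. (X, i) \<in> set w \<Longrightarrow> i \<in> X"
  shows "independence_number {..<n} (graph_edges n (chain_adj k W w)) \<le> 2 * k"
proof (rule independence_number_le)
  fix S assume S: "S \<subseteq> {..<n}" "indep S (graph_edges n (chain_adj k W w))"
  have nadj: "\<not> chain_adj k W w u v" if "u \<in> S" "v \<in> S" "u < v" for u v
    using indep_graph_edgesD[OF S(2,1)] that by blast
  show "card S \<le> 2 * k"
  proof (cases "\<exists>v\<in>S. block k W v \<ge> k")
    case True
    then obtain v where v: "v \<in> S" "block k W v \<ge> k" by blast
    \<comment> \<open>Padding vertices are adjacent to all earlier ones, and every vertex after a
      padding vertex is padding, so \<open>v\<close> is alone in \<open>S\<close>.\<close>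
    have "u = v" if "u \<in> S" for u
    proof (rule ccontr)
      assume "u \<noteq> v"
      then consider "u < v" | "v < u" by linarith
      then show False
        using nadj[of u v] nadj[of v u] v that block_mono[of v u k W]
        by cases (auto simp: chain_adj_def)
    qed
    then have "S \<subseteq> {v}" by auto
    then have "card S \<le> card {v}"
      by (intro card_mono) auto
    then show ?thesis
      using k by simp
  next
    case False
    define good where "good u \<longleftrightarrow> on_line k W (snd (w ! block k W u)) u" for u
    \<comment> \<open>Off the selected lines, \<open>S\<close> only meets a single block, and there each column at most once.\<close>
    define h where "h u = (if good u then block k W u else k + column k W u)" for u
    have distinct: "h u \<noteq> h v" if uv: "u \<in> S" "v \<in> S" "u < v" for u v
    proof
      assume eq: "h u = h v"
      have less: "block k W u < k" "block k W v < k"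
        using False uv by force+
      have "good u \<longleftrightarrow> good v"
        using eq less unfolding h_def by (auto split: if_splits)
      moreover have False if "good u" "good v"
      proof -
        have "block k W u = block k W v"
          using eq that by (simp add: h_def)
        moreover have "snd (w ! block k W v) \<in> fst (w ! block k W v)"
          using less w by (metis nth_mem prod.collapse)
        ultimately show False
          using nadj[OF uv] that by (auto simp: chain_adj_def good_def)
      qed
      moreover have False if "\<not> good u" "\<not> good v"
        using eq that nadj[OF uv] block_mono[of u v k W] \<open>u < v\<close>
        by (auto simp: chain_adj_def good_def h_def)
      ultimately show False by blast
    qed
    have "inj_on h S"
      by (rule linorder_inj_onI) (use distinct in auto)
    moreover have "h ` S \<subseteq> {..<2 * k}"
      using False column_less[OF k] by (force simp: h_def not_le intro: add_strict_mono)
    ultimately have "card S \<le> card {..<2 * k}"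
      by (intro card_inj_on_le) auto
    then show ?thesis by simp
  qed
qed simp

text \<open>The union of the selected lines is independent: across blocks selected points are
  spared, and within a block the only line through two of them is the selected one, whose bit is
  0.\<close>

lemma independence_number_chain_disjoint:
  assumes k: "k > 0" and n: "k * k * W \<le> n"
    and w: "length w = k" "\<And>X i. (X, i) \<in> set w \<Longrightarrow> i \<notin> X"
    and lines: "\<And>X i. (X, i) \<in> set w \<Longrightarrow> fst i * (k - 1) + snd i < W"
  shows "k * k \<le> independence_number {..<n} (graph_edges n (chain_adj k W w))"
proof -
  define pt where "pt = (\<lambda>(j, x). (j * k + x) * W + (fst (snd (w ! j)) * x + snd (snd (w ! j))))"
  define S where "S = pt ` ({..<k} \<times> {..<k})"
  \<comment> \<open>A line is highest in column \<open>k - 1\<close>, so \<open>lines\<close> keeps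
    its points from spilling into the next column.\<close>
  have off: "fst (snd (w ! j)) * x + snd (snd (w ! j)) < W" if "j < k" "x < k" for j x
  proof -
    have "fst (snd (w ! j)) * x \<le> fst (snd (w ! j)) * (k - 1)"
      using that by (intro mult_left_mono) auto
    moreover have "w ! j \<in> set w"
      using w that by simp
    then have "fst (snd (w ! j)) * (k - 1) + snd (snd (w ! j)) < W"
      using lines[of "fst (w ! j)" "snd (w ! j)"] by simp
    ultimately show ?thesis
      by linarith
  qed
  have pt: "pt (j, x) mod W = fst (snd (w ! j)) * x + snd (snd (w ! j))"
      "block k W (pt (j, x)) = j" "column k W (pt (j, x)) = x" "pt (j, x) < n" if "j < k" "x < k" for j x
  proof -
    note o = off[OF that]
    show "pt (j, x) mod W = fst (snd (w ! j)) * x + snd (snd (w ! j))"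
      using o by (simp add: pt_def)
    have div: "pt (j, x) div W = j * k + x"
      using o by (simp add: pt_def)
    then show "block k W (pt (j, x)) = j" "column k W (pt (j, x)) = x"
      using that by (simp_all add: block_def column_def)
    have "pt (j, x) < Suc (j * k + x) * W"
      using o by (simp add: pt_def)
    also have "Suc (j * k + x) \<le> Suc j * k"
      using that by simp
    also have "Suc j * k \<le> k * k"
      using that by (intro mult_right_mono) auto
    finally show "pt (j, x) < n"
      using n by (simp add: mult_right_mono)
  qed
  have inj: "inj_on pt ({..<k} \<times> {..<k})"
    by (rule inj_onI) (metis SigmaE lessThan_iff pt(2,3))
  have S: "block k W u < k" "on_line k W (snd (w ! block k W u)) u" "u < n" if "u \<in> S" for u
    using that pt by (auto simp: S_def on_line_def)
  have "indep S (graph_edges n (chain_adj k W w))"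
  proof (rule indep_graph_edgesI)
    fix u v assume uv: "u \<in> S" "v \<in> S" "u < v"
    show "\<not> chain_adj k W w u v"
    proof
      assume "chain_adj k W w u v"
      then have same: "block k W u = block k W v"
        and adj: "column k W u = column k W v \<or>
          (\<exists>l \<in> fst (w ! block k W v). on_line k W l u \<and> on_line k W l v)"
        using S[OF uv(1)] S[OF uv(2)] by (auto simp: chain_adj_def)
      have col: "column k W u \<noteq> column k W v"
        using same vertex_eqI[of k W u v] S[OF uv(1)] S[OF uv(2)] \<open>u < v\<close> by (auto simp: on_line_def)
      then obtain l where "l \<in> fst (w ! block k W v)" "on_line k W l u" "on_line k W l v"
        using adj by blast
      then have "snd (w ! block k W v) \<in> fst (w ! block k W v)"
        using line_unique[OF _ _ _ _ col, of l "snd (w ! block k W v)"] S[OF uv(1)] S[OF uv(2)] same by auto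
      moreover have "w ! block k W v \<in> set w"
        using S[OF uv(2)] w by simp
      ultimately show False
        using w by (metis prod.collapse)
    qed
  qed
  moreover have "S \<subseteq> {..<n}"
    using S by auto
  ultimately have "card S \<le> independence_number {..<n} (graph_edges n (chain_adj k W w))"
    by (intro card_le_independence_number) auto
  then show ?thesis
    using inj by (simp add: S_def card_image)
qed


section \<open>The lower bound\<close>

text \<open>The index problem: \<open>X\<close> encodes a bit string, \<open>i\<close> is the
  queried position and \<open>z\<close> the bit found there.\<close>

definition index_instances :: "'a set \<Rightarrow> bool \<Rightarrow> ('a set \<times> 'a) set" where
  "index_instances L z = {(X, i). X \<subseteq> L \<and> i \<in> L \<and> (i \<in> X \<longleftrightarrow> z)}"

lemma index_instances_Un: "index_instances L True \<union> index_instances L False = Pow L \<times> L"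
  by (auto simp: index_instances_def)

lemma finite_index_instances: "finite L \<Longrightarrow> finite (index_instances L z)"
  by (rule finite_subset[of _ "Pow L \<times> L"]) (auto simp: index_instances_def)

text \<open>Complementing \<open>X\<close> flips the queried bit, so each class is half of all
  pairs.\<close>

lemma card_index_instances:
  assumes "finite L"
  shows "2 * card (index_instances L z) = 2 ^ card L * card L"
proof -
  have "bij_betw (\<lambda>(X, i). (L - X, i)) (index_instances L True) (index_instances L False)"
    by (rule bij_betw_byWitness[where f' = "\<lambda>(X, i). (L - X, i)"]) (auto simp: index_instances_def)
  then have "card (index_instances L True) = card (index_instances L False)"
    by (rule bij_betw_same_card)
  moreover have "card (index_instances L True) + card (index_instances L False) = 2 ^ card L * card L"
  proof -
    have "card (index_instances L True \<union> index_instances L False) =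
        card (index_instances L True) + card (index_instances L False)"
      using finite_index_instances[OF assms]
      by (intro card_Un_disjoint) (simp_all, auto simp: index_instances_def)
    then show ?thesis
      using assms by (simp add: index_instances_Un card_cartesian_product card_Pow)
  qed
  ultimately show ?thesis
    by (cases z) auto
qed

lemma sum_index_instances_diff:
  fixes G :: "'a set \<times> 'a \<Rightarrow> real"
  assumes "finite L"
  shows "(\<Sum>b\<in>index_instances L True. G b) - (\<Sum>b\<in>index_instances L False. G b) =
    (\<Sum>X\<in>Pow L. \<Sum>i\<in>L. (if i \<in> X then 1 else - 1) * G (X, i))"
proof -
  let ?H = "\<lambda>(X, i). (if i \<in> X then 1 else - 1) * G (X, i)"
  have "(\<Sum>b\<in>index_instances L True. G b) = (\<Sum>b\<in>index_instances L True. ?H b)"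
    by (intro sum.cong) (auto simp: index_instances_def)
  moreover have "(\<Sum>b\<in>index_instances L False. G b) = - (\<Sum>b\<in>index_instances L False. ?H b)"
    unfolding sum_negf[symmetric] by (intro sum.cong) (auto simp: index_instances_def)
  moreover have "(\<Sum>b\<in>Pow L \<times> L. ?H b) =
      (\<Sum>b\<in>index_instances L True. ?H b) + (\<Sum>b\<in>index_instances L False. ?H b)"
    unfolding index_instances_Un[symmetric] using finite_index_instances[OF assms]
    by (intro sum.union_disjoint) (simp_all, auto simp: index_instances_def)
  ultimately show ?thesis
    by (simp add: sum.cartesian_product)
qed

text \<open>There are fewer than \<open>2 ^ Suc s\<close> such strings, and 2 \<le> e.\<close>

lemma ln_card_memories_le: "ln (real (card {q :: bool list. length q \<le> s})) \<le> real s + 1"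
proof -
  have "card {q :: bool list. length q \<le> s} = (\<Sum>i\<le>s. 2 ^ i)"
    using card_lists_length_le[of "UNIV :: bool set" s] by simp
  also have "\<dots> \<le> 2 ^ Suc s"
    by (induction s) auto
  finally have "real (card {q :: bool list. length q \<le> s}) \<le> 2 ^ Suc s"
    by (metis of_nat_le_iff of_nat_numeral of_nat_power)
  also have "\<dots> \<le> exp 1 ^ Suc s"
    using exp_ge_add_one_self[of 1] by (intro power_mono) auto
  also have "\<dots> = exp (real s + 1)"
    by (simp add: exp_of_nat_mult[symmetric] exp_add)
  finally have "real (card {q :: bool list. length q \<le> s}) \<le> exp (real s + 1)" .
  moreover have "finite {q :: bool list. length q \<le> s}"
    using finite_lists_length_le[of "UNIV :: bool set" s] by simp
  then have "card {q :: bool list. length q \<le> s} > 0"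
    by (auto simp: card_gt_0_iff intro: exI[of _ "[]"])
  ultimately show ?thesis
    by (metis ln_exp ln_mono of_nat_0_less_iff)
qed

section \<open>From streams to one-way messages\<close>

lemma block_less_iff: "k > 0 \<Longrightarrow> W > 0 \<Longrightarrow> block k W v < j \<longleftrightarrow> v < j * k * W"
  by (simp add: block_def div_less_iff_less_mult)

text \<open>Up to and including block \<open>length p\<close> the stream does not depend on \<open>i\<close>, afterwards not on \<open>X\<close>.\<close>

lemma chain_stream_split:
  assumes "k > 0" "W > 0" "k * k * W \<le> n" "length p + length r + 1 = k"
  defines "T \<equiv> Suc (length p) * k * W"
  shows "graph_stream n (chain_adj k W (p @ (X, i) # r)) =
    take T (graph_stream n (chain_adj k W (p @ (X, i') # r))) @
    drop T (graph_stream n (chain_adj k W (p @ (X', i) # r)))"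
proof -
  have "T \<le> k * k * W"
    unfolding T_def using assms by (intro mult_right_mono) auto
  then have T: "T \<le> n"
    using assms by linarith
  have block_T: "block k W v < Suc (length p) \<longleftrightarrow> v < T" for v
    unfolding T_def by (rule block_less_iff[OF assms(1,2)])
  \<comment> \<open>Adjacency to \<open>v\<close> reads the line set of its own block and the
    selections of earlier blocks only, so the selection \<open>i\<close> is not yet
    consulted.\<close>
  have 1: "arrival_of (chain_adj k W (p @ (X, i) # r)) v = arrival_of (chain_adj k W (p @ (X, i') # r)) v"
    if "v < T" for v
  proof -
    have "block k W v < Suc (length p)"
      using that block_T by simp
    then have "chain_adj k W (p @ (X, i) # r) u v = chain_adj k W (p @ (X, i') # r) u v" for u
      by (cases "block k W v = length p") (auto simp: chain_adj_def nth_append)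
    then show ?thesis
      by (simp add: arrival_of_def)
  qed
  have 2: "arrival_of (chain_adj k W (p @ (X, i) # r)) v = arrival_of (chain_adj k W (p @ (X', i) # r)) v"
    if "v \<ge> T" for v
  proof -
    have "\<not> block k W v < Suc (length p)"
      using that block_T by simp
    then have "chain_adj k W (p @ (X, i) # r) u v = chain_adj k W (p @ (X', i) # r) u v" for u
      by (auto simp: chain_adj_def nth_append nth_Cons split: nat.split)
    then show ?thesis
      by (simp add: arrival_of_def)
  qed
  have "[0..<n] = [0..<T] @ [T..<n]"
    using T upt_add_eq_append[of 0 T "n - T"] by simp
  then have "graph_stream n (chain_adj k W (p @ (X, i) # r)) =
      map (arrival_of (chain_adj k W (p @ (X, i) # r))) [0..<T] @
      map (arrival_of (chain_adj k W (p @ (X, i) # r))) [T..<n]"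
    unfolding graph_stream_def by (metis map_append)
  also have "\<dots> = map (arrival_of (chain_adj k W (p @ (X, i') # r))) [0..<T] @
      map (arrival_of (chain_adj k W (p @ (X', i) # r))) [T..<n]"
    using 1 2 by simp
  finally show ?thesis
    using T by (simp add: graph_stream_def take_map drop_map)
qed

text \<open>With all other blocks fixed, the memory at the end of a block is the message
  \<open>f X\<close>, and the rest of the run is the receiver \<open>g\<close>.\<close>

lemma chain_advantage_le:
  fixes acc :: "real \<Rightarrow> real" and x :: real and L :: "line set"
  assumes k: "k > 0" "W > 0" "k * k * W \<le> n" and L: "finite L"
    and space: "\<And>adj. space_on A (graph_stream n adj) \<le> s"
    and acc: "\<And>y. 0 \<le> acc y" "\<And>y. acc y \<le> 1" and x: "0 < x" "x \<le> 1"
  defines "F \<equiv> \<lambda>w. acc (result A (graph_stream n (chain_adj k W w)))"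
  shows "(\<Sum>w | set w \<subseteq> index_instances L True \<and> length w = k. F w) -
      (\<Sum>w | set w \<subseteq> index_instances L False \<and> length w = k. F w)
    \<le> k * card (index_instances L True) ^ (k - 1) * (2 ^ card L * ((real s + 1) / x + x * card L))"
proof (rule hybrid_bound)
  show "card (index_instances L False) = card (index_instances L True)"
    using card_index_instances[OF L, of True] card_index_instances[OF L, of False] by simp
  fix p r :: "(line set \<times> line) list"
  assume len: "length p + length r + 1 = k"
  define T where "T = Suc (length p) * k * W"
  \<comment> \<open>The line \<open>(0, 0)\<close> here and the set \<open>{}\<close> in
    \<open>g\<close> are placeholders that these stream parts never read.\<close>
  define f where "f X = memory_after A (take T (graph_stream n (chain_adj k W (p @ (X, (0, 0)) # r))))" for X
  define g where "g q i = acc (answer A (foldl (update_memory A) q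
      (drop T (graph_stream n (chain_adj k W (p @ ({}, i) # r))))))" for q i
  define Q where "Q = {q :: bool list. length q \<le> s}"
  have F: "F (p @ (X, i) # r) = g (f X) i" for X i
    using chain_stream_split[OF k len, of X i "(0, 0)" "{}"]
    by (simp add: F_def f_def g_def result_def memory_after_def T_def)
  have "(\<Sum>b\<in>index_instances L True. F (p @ b # r)) - (\<Sum>b\<in>index_instances L False. F (p @ b # r)) =
      (\<Sum>X\<in>Pow L. \<Sum>i\<in>L. (if i \<in> X then 1 else - 1) * g (f X) i)"
    by (simp only: sum_index_instances_diff[OF L] F)
  also have "\<dots> \<le> 2 ^ card L * (ln (card Q) / x + x * card L)"
  proof (rule index_correlation_bound[OF L])
    show "finite Q"
      using finite_lists_length_le[of "UNIV :: bool set" s] by (simp add: Q_def)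
    show "f X \<in> Q" for X
      unfolding f_def Q_def mem_Collect_eq by (rule order_trans[OF length_memory_after_le_space_on space])
  qed (use acc x in \<open>auto simp: g_def\<close>)
  also have "\<dots> \<le> 2 ^ card L * ((real s + 1) / x + x * card L)"
    using x ln_card_memories_le[of s] by (auto simp: Q_def intro!: divide_right_mono)
  finally show "(\<Sum>b\<in>index_instances L True. F (p @ b # r)) - (\<Sum>b\<in>index_instances L False. F (p @ b # r))
      \<le> 2 ^ card L * ((real s + 1) / x + x * card L)" .
qed (use L finite_index_instances in auto)

section \<open>From randomised algorithms to the space bound\<close>

lemma approximates_graph_stream:
  assumes "prob_space M" "approximates_independence_number M n c (2 / 3)"
  defines "S \<equiv> \<lambda>adj. {A \<in> space M. is_approx c (real (independence_number {..<n} (graph_edges n adj)))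
    (result A (graph_stream n adj))}"
  shows "measure M (S adj) \<ge> 2 / 3" "S adj \<in> sets M"
proof -
  show *: "measure M (S adj) \<ge> 2 / 3"
    using assms(2) simple_graph_graph_edges explicit_vertex_stream_graph_stream
    unfolding approximates_independence_number_def S_def by blast
  \<comment> \<open>A non-measurable set has measure 0 by default, so a positive measure forces
    measurability.\<close>
  show "S adj \<in> sets M"
    using * measure_notin_sets[of "S adj" M] by force
qed

lemma uses_space_graph_stream:
  assumes "uses_space M n s"
  shows "AE A in M. \<forall>adj. space_on A (graph_stream n adj) \<le> s"
  using assms unfolding uses_space_def
  by (rule AE_mp) (auto intro!: AE_I2 intro: simple_graph_graph_edges explicit_vertex_stream_graph_stream)

text \<open>Success probability 2/3 on both families exceeds the \<open>b ^ k\<close> instances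
  solved by a constant guess by \<open>b ^ k / 3\<close>, while \<open>chain_advantage_le\<close>
  caps this excess.\<close>

lemma space_lower_bound_lines:
  assumes M: "prob_space M" "approximates_independence_number M n c (2 / 3)" "uses_space M n s"
    and c: "1 \<le> c" "2 * c < real k" and W: "W > 0" "k * k * W \<le> n"
    and L: "finite L" "L \<noteq> {}" "\<And>l. l \<in> L \<Longrightarrow> fst l * (k - 1) + snd l < W"
  shows "real (card L) \<le> 144 * real k ^ 2 * (real s + 1)"
proof -
  interpret prob_space M by fact
  define E where "E w = graph_edges n (chain_adj k W w)" for w
  define xs where "xs w = graph_stream n (chain_adj k W w)" for w
  define S where "S w = {A \<in> space M. is_approx c (real (independence_number {..<n} (E w))) (result A (xs w))}" for w
  define \<Omega> where "\<Omega> z = {w. set w \<subseteq> index_instances L z \<and> length w = k}" for z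
  \<comment> \<open>The threshold separates correct answers: \<alpha> is at most
    \<open>2 * k\<close> in one family and at least \<open>k * k > 2 * k * c\<close> in the
    other.\<close>
  define acc where "acc y = (if y \<le> 2 * real k then 1 else 0 :: real)" for y
  define b where "b = real (card (index_instances L True))"
  \<comment> \<open>Chosen so that \<open>6 * k * x * card L\<close> is \<open>card L / 2\<close>,
    which the left side absorbs at the end.\<close>
  define x where "x = 1 / (12 * real k)"
  define D where "D = 2 ^ card L * ((real s + 1) / x + x * card L)"
  have k: "k > 0"
    using c by (cases k) auto
  have x: "0 < x" "x \<le> 1"
    using k by (auto simp: x_def)
  have "real (2 * card (index_instances L True)) = real (2 ^ card L * card L)"
    by (simp only: card_index_instances[OF \<open>finite L\<close>])
  then have b1: "2 * b = 2 ^ card L * card L"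
    by (simp add: b_def)
  have b2: "b = real (card (index_instances L z))" for z
    using card_index_instances[OF \<open>finite L\<close>, of z] card_index_instances[OF \<open>finite L\<close>, of True]
    by (simp add: b_def)
  have \<Omega>: "finite (\<Omega> z)" "real (card (\<Omega> z)) = b ^ k" for z
    using finite_index_instances[OF \<open>finite L\<close>] b2[of z]
    by (auto simp: \<Omega>_def card_lists_length_eq finite_lists_length_eq)
  have prob: "prob (S w) \<ge> 2 / 3" "S w \<in> events" for w
    using approximates_graph_stream[OF M(1,2)] by (auto simp: S_def E_def xs_def)
  have yes: "indicator (S w) A \<le> acc (result A (xs w))" if "w \<in> \<Omega> True" for w A
  proof (cases "A \<in> S w")
    case True
    have "independence_number {..<n} (E w) \<le> 2 * k"
      unfolding E_def using that k
      by (intro independence_number_chain_intersecting) (auto simp: \<Omega>_def index_instances_def)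
    then have "real (independence_number {..<n} (E w)) \<le> 2 * real k"
      by linarith
    then show ?thesis
      using True by (auto simp: S_def is_approx_def acc_def)
  qed (auto simp: acc_def)
  have no: "indicator (S w) A \<le> 1 - acc (result A (xs w))" if "w \<in> \<Omega> False" for w A
  proof (cases "A \<in> S w")
    case True
    have "k * k \<le> independence_number {..<n} (E w)"
      unfolding E_def using that k W L(3)
      by (intro independence_number_chain_disjoint) (auto simp: \<Omega>_def index_instances_def)
    then have "real k * real k \<le> real (independence_number {..<n} (E w))"
      by (metis of_nat_le_iff of_nat_mult)
    moreover have "2 * real k * c < real k * real k"
      using c k by simp
    moreover have "real (independence_number {..<n} (E w)) \<le> c * result A (xs w)"
      using True c by (auto simp: S_def is_approx_def field_simps)
    ultimately have "c * (2 * real k) < c * result A (xs w)"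
      by (simp add: algebra_simps)
    then have "2 * real k < result A (xs w)"
      using c by simp
    then show ?thesis
      by (auto simp: acc_def indicator_def)
  qed (auto simp: acc_def)
  have AE: "AE A in M. (\<Sum>(z, w)\<in>Sigma UNIV \<Omega>. indicator (S w) A) \<le> b ^ k + k * b ^ (k - 1) * D"
    using uses_space_graph_stream[OF M(3)]
  proof (rule AE_mp, intro AE_I2 impI)
    fix A assume space: "\<forall>adj. space_on A (graph_stream n adj) \<le> s"
    have "(\<Sum>(z, w)\<in>Sigma UNIV \<Omega>. indicator (S w) A) =
        (\<Sum>w\<in>\<Omega> True. indicator (S w) A) + (\<Sum>w\<in>\<Omega> False. indicator (S w) A :: real)"
      using \<Omega> by (subst sum.Sigma[symmetric]) (auto simp: UNIV_bool)
    also have "\<dots> \<le> (\<Sum>w\<in>\<Omega> True. acc (result A (xs w))) + (\<Sum>w\<in>\<Omega> False. 1 - acc (result A (xs w)))"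
      by (intro add_mono sum_mono yes no)
    also have "\<dots> = b ^ k + ((\<Sum>w\<in>\<Omega> True. acc (result A (xs w))) - (\<Sum>w\<in>\<Omega> False. acc (result A (xs w))))"
      by (simp add: sum_subtractf \<Omega>)
    also have "(\<Sum>w\<in>\<Omega> True. acc (result A (xs w))) - (\<Sum>w\<in>\<Omega> False. acc (result A (xs w)))
        \<le> k * b ^ (k - 1) * D"
      using chain_advantage_le[OF k W \<open>finite L\<close> _ _ _ x, of A s acc] space
      by (simp add: \<Omega>_def xs_def b_def D_def acc_def)
    finally show "(\<Sum>(z, w)\<in>Sigma UNIV \<Omega>. indicator (S w) A) \<le> b ^ k + k * b ^ (k - 1) * D"
      by simp
  qed
  have "4 / 3 * b ^ k = (\<Sum>(z, w)\<in>Sigma UNIV \<Omega>. 2 / 3)"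
    using \<Omega> by (subst sum.Sigma[symmetric]) (auto simp: UNIV_bool)
  also have "\<dots> \<le> (\<Sum>(z, w)\<in>Sigma UNIV \<Omega>. prob (S w))"
    by (intro sum_mono) (simp only: case_prod_unfold prob)
  also have "\<dots> \<le> b ^ k + k * b ^ (k - 1) * D"
    using sum_prob_le_if_AE[of "Sigma UNIV \<Omega>" "\<lambda>(z, w). S w"] AE prob \<Omega>
    by (simp add: case_prod_unfold)
  \<comment> \<open>Subtracting \<open>b ^ k\<close> leaves \<open>b ^ k / 3\<close>; one factor
    \<open>b\<close> is split off so that \<open>b ^ (k - 1)\<close> cancels.\<close>
  finally have "b ^ (k - 1) * b \<le> b ^ (k - 1) * (3 * k * D)"
    using k by (cases k) (auto simp: algebra_simps)
  moreover have "card L > 0"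
    using L(1,2) by (simp add: card_gt_0_iff)
  then have "0 < 2 * b"
    unfolding b1 by simp
  ultimately have "b \<le> 3 * k * D"
    by simp
  then have "2 ^ card L * real (card L) \<le> 6 * real k * D"
    using b1 by simp
  also have "\<dots> = 2 ^ card L * (6 * real k * ((real s + 1) / x + x * card L))"
    by (simp add: D_def)
  finally have "real (card L) \<le> 6 * real k * ((real s + 1) / x + x * card L)"
    by simp
  also have "\<dots> = 72 * real k ^ 2 * (real s + 1) + real (card L) / 2"
    using k by (simp add: x_def field_simps power2_eq_square)
  finally show ?thesis
    by simp
qed

text \<open>Without memory the answer is the same on the complete and the empty graph, whose
  independence numbers are more than a factor \<open>c\<close> apart. The success events are then
  almost surely disjoint, yet each has probability at least 2/3.\<close>

lemma space_positive:
  assumes M: "prob_space M" "approximates_independence_number M n c (2 / 3)" "uses_space M n s"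
    and c: "1 \<le> c" "c < real n"
  shows "s > 0"
proof (rule ccontr)
  assume "\<not> s > 0"
  interpret prob_space M by fact
  define S where "S z = {A \<in> space M. is_approx c
    (real (independence_number {..<n} (graph_edges n (\<lambda>_ _. z)))) (result A (graph_stream n (\<lambda>_ _. z)))}" for z
  have prob: "prob (S z) \<ge> 2 / 3" "S z \<in> events" for z
    using approximates_graph_stream[OF M(1,2)] by (auto simp: S_def)
  have complete: "independence_number {..<n} (graph_edges n (\<lambda>_ _. True)) \<le> 1"
  proof (rule independence_number_le)
    fix S assume "S \<subseteq> {..<n}" "indep S (graph_edges n (\<lambda>_ _. True))"
    then have "\<And>u v. u \<in> S \<Longrightarrow> v \<in> S \<Longrightarrow> u = v"
      using indep_graph_edgesD by (metis linorder_neqE_nat)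
    then show "card S \<le> 1"
      by (metis One_nat_def card_le_Suc0_iff_eq card.infinite zero_le)
  qed simp
  have empty: "n \<le> independence_number {..<n} (graph_edges n (\<lambda>_ _. False))"
    using card_le_independence_number[of "{..<n}" "{..<n}"] indep_graph_edgesI[of "{..<n}" "\<lambda>_ _. False"]
    by simp
  have "AE A in M. (\<Sum>z\<in>UNIV. indicator (S z) A) \<le> (1 :: real)"
    using uses_space_graph_stream[OF M(3)]
  proof (rule AE_mp, intro AE_I2 impI)
    fix A assume "\<forall>adj. space_on A (graph_stream n adj) \<le> s"
    then have "length (memory_after A (graph_stream n adj)) = 0" for adj
      using length_memory_after_le_space_on[of A n "graph_stream n adj"] \<open>\<not> s > 0\<close>
      by (simp add: graph_stream_def)
    then have "result A (graph_stream n (\<lambda>_ _. True)) = result A (graph_stream n (\<lambda>_ _. False))"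
      by (simp add: result_def)
    moreover have "result A (graph_stream n (\<lambda>_ _. True)) \<le> 1" if "A \<in> S True"
      using that complete by (auto simp: S_def is_approx_def)
    moreover have "result A (graph_stream n (\<lambda>_ _. False)) > 1" if "A \<in> S False"
    proof -
      have "real n \<le> c * result A (graph_stream n (\<lambda>_ _. False))"
        using that c empty by (auto simp: S_def is_approx_def field_simps)
      then have "c * 1 < c * result A (graph_stream n (\<lambda>_ _. False))"
        using c by linarith
      then show ?thesis
        using c by simp
    qed
    ultimately have "\<not> (A \<in> S True \<and> A \<in> S False)"
      by force
    then show "(\<Sum>z\<in>UNIV. indicator (S z) A) \<le> (1 :: real)"
      by (cases "A \<in> S True"; cases "A \<in> S False") (simp_all add: UNIV_bool)
  qed
  then have "(\<Sum>z\<in>UNIV. prob (S z)) \<le> 1"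
    using prob by (intro sum_prob_le_if_AE) auto
  then show False
    using prob(1)[of True] prob(1)[of False] by (simp add: UNIV_bool)
qed

theorem theorem8:
  shows "\<exists>K>0. \<forall>(n::nat) (c::real) (s::nat) (M::stream_alg measure).
    prob_space M \<and> 1 \<le> c \<and> (0 < s \<or> c < real n) \<and>
    approximates_independence_number M n c (2 / 3) \<and> uses_space M n s \<longrightarrow>
      real s \<ge> K * (real n ^ 2 / c ^ 7)"
\<comment> \<open>\<open>9216 = 32 * 288\<close> collects the constants below; \<open>3 ^ 7\<close>
  comes from \<open>k \<le> 3 * c\<close>.\<close>
proof (intro exI[of _ "1 / (9216 * 3 ^ 7)"] conjI allI impI)
  fix n s :: nat and c :: real and M :: "stream_alg measure"
  assume A: "prob_space M \<and> 1 \<le> c \<and> (0 < s \<or> c < real n) \<and>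
    approximates_independence_number M n c (2 / 3) \<and> uses_space M n s"
  then have c: "1 \<le> c" by simp
  have s: "s > 0"
    using A space_positive by blast
  define k where "k = nat \<lfloor>2 * c\<rfloor> + 1"
  have k: "2 * c < real k" "real k \<le> 3 * c" "k > 0"
    using c by (auto simp: k_def) linarith+
  \<comment> \<open>Keeping slopes below \<open>m div k\<close> confines the lines to columns of height \<open>2 * m\<close>; for
    \<open>n < 4 * k ^ 3\<close> there may be no such line, but then \<open>s > 0\<close> suffices.\<close>
  have "real n ^ 2 \<le> 9216 * real k ^ 7 * real s"
  proof (cases "n < 4 * k ^ 3")
    case True
    then have "real n \<le> 4 * real k ^ 3"
      by (metis less_imp_le of_nat_le_iff of_nat_mult of_nat_numeral of_nat_power)
    then have "real n ^ 2 \<le> (4 * real k ^ 3) ^ 2"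
      by (intro power_mono) auto
    also have "\<dots> = 16 * real k ^ 6 * 1"
      by (simp add: power_mult_distrib flip: power_mult)
    also have "\<dots> \<le> 9216 * real k ^ 7 * real s"
      using s k(3) by (intro mult_mono power_increasing) auto
    finally show ?thesis .
  next
    case False
    \<comment> \<open>\<open>k * k\<close> columns of height \<open>2 * m\<close> fit into
      \<open>n\<close> vertices.\<close>
    define m where "m = n div (2 * k ^ 2)"
    define L where "L = {..<m div k} \<times> {..<m}"
    \<comment> \<open>Hence rounding in the two divisions costs at most a factor 2 each.\<close>
    have m: "2 * k \<le> m"
      using False k(3) by (simp add: m_def less_eq_div_iff_mult_less_eq power2_eq_square power3_eq_cube algebra_simps)
    have n: "k * k * (2 * m) \<le> n"
      using div_times_less_eq_dividend[of n "2 * k ^ 2"] by (simp add: m_def power2_eq_square algebra_simps)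
    have "real n < 2 * real k ^ 2 * (real m + 1)"
    proof -
      have "n < 2 * k ^ 2 * (m + 1)"
        using dividend_less_div_times[of "2 * k ^ 2" n] k(3) by (simp add: m_def algebra_simps)
      then have "real n < real (2 * k ^ 2 * (m + 1))"
        by (simp only: of_nat_less_iff)
      then show ?thesis by (simp add: distrib_left)
    qed
    also have "\<dots> \<le> 2 * real k ^ 2 * (2 * real m)"
      using m k(3) by (intro mult_left_mono) auto
    finally have nm: "real n \<le> 4 * real k ^ 2 * real m"
      by simp
    have mk: "real m \<le> 2 * real k * real (m div k)"
    proof -
      have "m < (m div k + 1) * k"
        using dividend_less_div_times[of k m] k(3) by simp
      also have "\<dots> \<le> (2 * (m div k)) * k"
        using m k(3) by (intro mult_right_mono) (auto simp: less_eq_div_iff_mult_less_eq Suc_le_eq div_greater_zero_iff)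
      finally have "real m \<le> real (2 * (m div k) * k)"
        by (simp only: of_nat_le_iff)
      then show ?thesis by (simp add: algebra_simps)
    qed
    have line: "fst l * (k - 1) + snd l < 2 * m" if "l \<in> L" for l
    proof -
      have "fst l * (k - 1) \<le> (m div k) * k"
        using that by (intro mult_mono) (auto simp: L_def)
      also have "\<dots> \<le> m"
        by simp
      finally show ?thesis
        using that by (auto simp: L_def)
    qed
    have "real (card L) \<le> 144 * real k ^ 2 * (real s + 1)"
    proof (rule space_lower_bound_lines)
      show "L \<noteq> {}"
        using m k(3) by (auto simp: L_def lessThan_empty_iff div_eq_0_iff)
    qed (use A k m n line in \<open>auto simp: L_def\<close>)
    also have "\<dots> \<le> 144 * real k ^ 2 * (2 * real s)"
      using s by (intro mult_left_mono) auto
    finally have L: "real (m div k) * real m \<le> 288 * real k ^ 2 * real s"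
      by (simp add: L_def card_cartesian_product)
    have "real n ^ 2 \<le> (4 * real k ^ 2 * real m) ^ 2"
      using nm by (intro power_mono) auto
    also have "\<dots> = 16 * real k ^ 4 * (real m * real m)"
      by algebra
    also have "\<dots> \<le> 16 * real k ^ 4 * ((2 * real k * real (m div k)) * real m)"
      using mk by (intro mult_left_mono mult_right_mono) auto
    also have "\<dots> = 32 * real k ^ 5 * (real (m div k) * real m)"
      by algebra
    also have "\<dots> \<le> 32 * real k ^ 5 * (288 * real k ^ 2 * real s)"
      using L by (intro mult_left_mono) auto
    also have "\<dots> = 9216 * real k ^ 7 * real s"
      by algebra
    finally show ?thesis .
  qed
  also have "\<dots> \<le> 9216 * (3 * c) ^ 7 * real s"
    using k by (intro mult_right_mono mult_left_mono power_mono) auto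
  finally show "1 / (9216 * 3 ^ 7) * (real n ^ 2 / c ^ 7) \<le> real s"
    using c by (simp add: field_simps power_mult_distrib)
qed simp

end
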